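(* Among the distributions on $X$ of the form $\{E_i,E_j,E_k\}$ with $i,j,k\in\{1,\dots,6\}$ distinct, the only ones which satisfy the special Lagrangian equations of angle $0$ (i.e. on which $\omega$ and $\mathrm{Im}\,\Omega$ vanish) are $$\{E_1,E_2,E_3\},\qquad \{E_1,E_5,E_6\},\qquad \{E_2,E_4,E_6\},\qquad \{E_3,E_4,E_5\}.$$
   Context: $X=\Gamma\backslash G$ is a compact 6-dimensional manifold, the quotient of a connected and simply connected Lie group $G$ by a lattice $\Gamma$ (discrete co-compact subgroup). $X$ carries the structure of a compact non-Kähler Calabi-Yau manifold, with complex structure $J$ given by a global co-frame of $(1,0)$-forms $\{\varphi^1,\varphi^2,\varphi^3\}$, holomorphic volume form $\Omega=\varphi^1\wedge\varphi^2\wedge\varphi^3$, and Hermitian metric with fundamental form $\omega=\frac{i}{2}(\varphi^1\wedge\bar\varphi^1+\varphi^2\wedge\bar\varphi^2+\varphi^3\wedge\bar\varphi^3)$, assumed balanced: $d\omega^2=0$. Write $\varphi^k=\theta^k+\sqrt{-1}\,\theta^{3+k}$, $k=1,2,3$; $\{\theta^1,\dots,\theta^6\}$ is a global real co-frame and $\{E_1,\dots,E_6\}$ is the dual global frame. An oriented 3-dimensional submanifold $L$ is a special Lagrangian (SLag) of angle $\vartheta$ if $\omega|_L=0$ and $\mathrm{Im}(e^{-i\vartheta}\Omega)|_L=0$; a distribution satisfies the equations if these forms vanish on it. Distributions are considered as unordered triples. *)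

theory Defs
  imports
    "HOL-Analysis.Analysis"
    "HOL-Combinatorics.Permutations"
    "HOL-Algebra.Coset"
begin

section \<open>Smooth maps and Lie groups\<close>

text \<open>
  Iterated directional derivatives; intended for an open subset \<open>S\<close> of a finite-dimensional
  space, where continuity of all directional derivatives of order \<open>n\<close> is the usual notion of
  class \<open>C\<^sup>n\<close>.
\<close>

primrec C_k_on :: "nat \<Rightarrow> 'a::real_normed_vector set \<Rightarrow> ('a \<Rightarrow> 'b::real_normed_vector) \<Rightarrow> bool" where
  "C_k_on 0 S f \<longleftrightarrow> continuous_on S f"
| "C_k_on (Suc n) S f \<longleftrightarrow>
     (\<forall>x\<in>S. f differentiable (at x)) \<and>
     (\<forall>v. C_k_on n S (\<lambda>x. frechet_derivative f (at x) v))"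

definition smooth_on :: "'a::real_normed_vector set \<Rightarrow> ('a \<Rightarrow> 'b::real_normed_vector) \<Rightarrow> bool" where
  "smooth_on S f \<longleftrightarrow> (\<forall>n. C_k_on n S f)"

type_synonym 'g chart = "'g set \<times> ('g \<Rightarrow> real ^ 6)"

definition smooth_atlas :: "'g::topological_space chart set \<Rightarrow> bool" where
  "smooth_atlas A \<longleftrightarrow>
     (\<Union>(U, c)\<in>A. U) = UNIV \<and>
     (\<forall>(U, c)\<in>A. open U \<and> open (c ` U) \<and> homeomorphism U (c ` U) c (inv_into U c)) \<and>
     (\<forall>(U, c)\<in>A. \<forall>(V, d)\<in>A. smooth_on (c ` (U \<inter> V)) (\<lambda>p. d (inv_into U c p)))"

definition smooth_fun :: "'g chart set \<Rightarrow> ('g \<Rightarrow> real) \<Rightarrow> bool" where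
  "smooth_fun A f \<longleftrightarrow> (\<forall>(U, c)\<in>A. smooth_on (c ` U) (\<lambda>p. f (inv_into U c p)))"

text \<open>
  The underlying manifold of the group is the whole type. Continuity of the operations makes the
  domains of their chart representations open.
\<close>

definition lie_group :: "'g::{t2_space, second_countable_topology} monoid \<Rightarrow> 'g chart set \<Rightarrow> bool" where
  "lie_group G A \<longleftrightarrow>
     group G \<and> carrier G = UNIV \<and> smooth_atlas A \<and>
     continuous_on UNIV (\<lambda>(g, h). g \<otimes>\<^bsub>G\<^esub> h) \<and>
     continuous_on UNIV (\<lambda>g. inv\<^bsub>G\<^esub> g) \<and>
     (\<forall>(U, c)\<in>A. \<forall>(V, d)\<in>A. \<forall>(W, e)\<in>A.
        smooth_on {(c g, d h) | g h. g \<in> U \<and> h \<in> V \<and> g \<otimes>\<^bsub>G\<^esub> h \<in> W}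
          (\<lambda>(p, q). e (inv_into U c p \<otimes>\<^bsub>G\<^esub> inv_into V d q))) \<and>
     (\<forall>(U, c)\<in>A. \<forall>(V, d)\<in>A.
        smooth_on {c g | g. g \<in> U \<and> inv\<^bsub>G\<^esub> g \<in> V} (\<lambda>p. d (inv\<^bsub>G\<^esub> (inv_into U c p))))"

section \<open>The quotient by a lattice\<close>

definition quotient_topology :: "'g::topological_space monoid \<Rightarrow> 'g set \<Rightarrow> 'g set topology" where
  "quotient_topology G \<Gamma> =
     topology (\<lambda>U. U \<subseteq> rcosets\<^bsub>G\<^esub> \<Gamma> \<and> open {g. \<Gamma> #>\<^bsub>G\<^esub> g \<in> U})"

lemma openin_quotient_topology:
  "openin (quotient_topology G \<Gamma>) U \<longleftrightarrow>
     U \<subseteq> rcosets\<^bsub>G\<^esub> \<Gamma> \<and> open {g. \<Gamma> #>\<^bsub>G\<^esub> g \<in> U}"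
proof -
  let ?P = "\<lambda>U. U \<subseteq> rcosets\<^bsub>G\<^esub> \<Gamma> \<and> open {g. \<Gamma> #>\<^bsub>G\<^esub> g \<in> U}"
  have "?P (S \<inter> T)" if "?P S" "?P T" for S T
  proof -
    have "{g. \<Gamma> #>\<^bsub>G\<^esub> g \<in> S \<inter> T} = {g. \<Gamma> #>\<^bsub>G\<^esub> g \<in> S} \<inter> {g. \<Gamma> #>\<^bsub>G\<^esub> g \<in> T}"
      by blast
    with that show ?thesis by (metis open_Int le_infI1)
  qed
  moreover have "?P (\<Union> K)" if "\<forall>S\<in>K. ?P S" for K
  proof -
    have "{g. \<Gamma> #>\<^bsub>G\<^esub> g \<in> \<Union> K} = (\<Union>S\<in>K. {g. \<Gamma> #>\<^bsub>G\<^esub> g \<in> S})"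
      by blast
    moreover have "open (\<Union>S\<in>K. {g. \<Gamma> #>\<^bsub>G\<^esub> g \<in> S})"
      using that by (intro open_UN) blast
    moreover have "\<Union> K \<subseteq> rcosets\<^bsub>G\<^esub> \<Gamma>"
      using that by (intro Sup_least) blast
    ultimately show ?thesis by (simp only:)
  qed
  ultimately have "istopology ?P"
    unfolding istopology_def by blast
  then show ?thesis
    unfolding quotient_topology_def by (simp only: topology_inverse')
qed

lemma quotient_map_cosets:
  assumes "carrier G = UNIV"
  shows "quotient_map euclidean (quotient_topology G \<Gamma>) (\<lambda>g. \<Gamma> #>\<^bsub>G\<^esub> g)"
proof -
  have im: "range (\<lambda>g. \<Gamma> #>\<^bsub>G\<^esub> g) = rcosets\<^bsub>G\<^esub> \<Gamma>"
    unfolding RCOSETS_def assms by blast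
  then have "{g. \<Gamma> #>\<^bsub>G\<^esub> g \<in> rcosets\<^bsub>G\<^esub> \<Gamma>} = UNIV"
    by blast
  then have "openin (quotient_topology G \<Gamma>) (rcosets\<^bsub>G\<^esub> \<Gamma>)"
    by (simp only: openin_quotient_topology open_UNIV subset_refl simp_thms)
  moreover have "topspace (quotient_topology G \<Gamma>) \<subseteq> rcosets\<^bsub>G\<^esub> \<Gamma>"
    using openin_topspace openin_quotient_topology by metis
  ultimately have "topspace (quotient_topology G \<Gamma>) = rcosets\<^bsub>G\<^esub> \<Gamma>"
    using openin_subset by blast
  with im show ?thesis
    unfolding quotient_map_def openin_quotient_topology by simp
qed

definition is_lattice :: "'g::topological_space monoid \<Rightarrow> 'g set \<Rightarrow> bool" where
  "is_lattice G \<Gamma> \<longleftrightarrow> subgroup \<Gamma> G \<and> discrete \<Gamma> \<and> compact_space (quotient_topology G \<Gamma>)"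

text \<open>
  A discrete subgroup acts freely and properly discontinuously by left translations, so
  \<open>g \<mapsto> \<Gamma>g\<close> is a smooth covering, and a function on the quotient is smooth iff its pull-back
  to the group is. The smooth structure of the quotient enters only through this algebra of smooth
  functions. Functions on the quotient are total functions that vanish off the set of cosets.
\<close>

definition quotient_smooth :: "'g monoid \<Rightarrow> 'g chart set \<Rightarrow> 'g set \<Rightarrow> ('g set \<Rightarrow> real) set" where
  "quotient_smooth G A \<Gamma> =
     {f. (\<forall>x. x \<notin> rcosets\<^bsub>G\<^esub> \<Gamma> \<longrightarrow> f x = 0) \<and> smooth_fun A (\<lambda>g. f (\<Gamma> #>\<^bsub>G\<^esub> g))}"

section \<open>Tangent vectors, vector fields and differential forms\<close>

text \<open>
  Below, \<open>X\<close> is the underlying set of a smooth manifold and \<open>C\<close> its algebra of smooth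
  functions, extended by zero off \<open>X\<close>. A tangent vector at \<open>x\<close> is a derivation of \<open>C\<close> at \<open>x\<close>,
  extended by zero off \<open>C\<close>.
\<close>

type_synonym 'x tangent_vector = "('x \<Rightarrow> real) \<Rightarrow> real"
type_synonym 'x vector_field = "'x \<Rightarrow> 'x tangent_vector"

definition tangent_space :: "('x \<Rightarrow> real) set \<Rightarrow> 'x \<Rightarrow> 'x tangent_vector set" where
  "tangent_space C x =
     {v. (\<forall>f. f \<notin> C \<longrightarrow> v f = 0) \<and>
         (\<forall>f\<in>C. \<forall>g\<in>C. \<forall>a b. v (\<lambda>y. a * f y + b * g y) = a * v f + b * v g) \<and>
         (\<forall>f\<in>C. \<forall>g\<in>C. v (\<lambda>y. f y * g y) = f x * v g + g x * v f)}"

definition lin :: "real \<Rightarrow> 'x tangent_vector \<Rightarrow> real \<Rightarrow> 'x tangent_vector \<Rightarrow> 'x tangent_vector" where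
  "lin a v b w = (\<lambda>f. a * v f + b * w f)"

definition vector_fields :: "'x set \<Rightarrow> ('x \<Rightarrow> real) set \<Rightarrow> 'x vector_field set" where
  "vector_fields X C =
     {V. (\<forall>x\<in>X. V x \<in> tangent_space C x) \<and> (\<forall>x. x \<notin> X \<longrightarrow> V x = (\<lambda>_. 0)) \<and>
         (\<forall>f\<in>C. (\<lambda>x. V x f) \<in> C)}"

definition lie_bracket ::
    "('x \<Rightarrow> real) set \<Rightarrow> 'x vector_field \<Rightarrow> 'x vector_field \<Rightarrow> 'x vector_field" where
  "lie_bracket C V W =
     (\<lambda>x f. if f \<in> C then V x (\<lambda>y. W y f) - W x (\<lambda>y. V y f) else 0)"

text \<open>A complex-valued \<open>k\<close>-form takes a point and a list of \<open>k\<close> tangent vectors at that point.\<close>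

type_synonym 'x form = "'x \<Rightarrow> 'x tangent_vector list \<Rightarrow> complex"

definition on_fields :: "'x form \<Rightarrow> 'x vector_field list \<Rightarrow> 'x \<Rightarrow> complex" where
  "on_fields \<alpha> Vs = (\<lambda>x. \<alpha> x (map (\<lambda>V. V x) Vs))"

definition is_form :: "'x set \<Rightarrow> ('x \<Rightarrow> real) set \<Rightarrow> nat \<Rightarrow> 'x form \<Rightarrow> bool" where
  "is_form X C k \<alpha> \<longleftrightarrow>
     (\<forall>x vs. x \<notin> X \<longrightarrow> \<alpha> x vs = 0) \<and>
     (\<forall>x\<in>X. \<forall>vs. length vs = k \<and> set vs \<subseteq> tangent_space C x \<longrightarrow>
        (\<forall>i<k. \<forall>v\<in>tangent_space C x. \<forall>w\<in>tangent_space C x. \<forall>a b.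
           \<alpha> x (vs[i := lin a v b w]) =
             of_real a * \<alpha> x (vs[i := v]) + of_real b * \<alpha> x (vs[i := w])) \<and>
        (\<forall>i j. i < j \<and> j < k \<and> vs ! i = vs ! j \<longrightarrow> \<alpha> x vs = 0)) \<and>
     (\<forall>Vs. length Vs = k \<and> set Vs \<subseteq> vector_fields X C \<longrightarrow>
        (\<lambda>x. Re (on_fields \<alpha> Vs x)) \<in> C \<and> (\<lambda>x. Im (on_fields \<alpha> Vs x)) \<in> C)"

text \<open>
  The exterior product of a \<open>p\<close>-form and a \<open>q\<close>-form, normalised so that
  \<open>(\<alpha> \<and> \<beta>)(v, w) = \<alpha>(v) \<beta>(w) - \<alpha>(w) \<beta>(v)\<close> for 1-forms.
\<close>

definition wedge :: "nat \<Rightarrow> nat \<Rightarrow> 'x form \<Rightarrow> 'x form \<Rightarrow> 'x form" where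
  "wedge p q \<alpha> \<beta> = (\<lambda>x vs.
     (\<Sum>\<sigma> | \<sigma> permutes {..<p + q}.
        of_int (sign \<sigma>) *
        \<alpha> x (map (\<lambda>i. vs ! \<sigma> i) [0..<p]) * \<beta> x (map (\<lambda>i. vs ! \<sigma> i) [p..<p + q]))
     / (fact p * fact q))"

definition cderiv :: "'x tangent_vector \<Rightarrow> ('x \<Rightarrow> complex) \<Rightarrow> complex" where
  "cderiv v f = Complex (v (\<lambda>x. Re (f x))) (v (\<lambda>x. Im (f x)))"

text \<open>
  The invariant (Koszul) formula for \<open>d\<alpha>(V\<^sub>0, \<dots>, V\<^sub>k)\<close>, where \<open>\<alpha>\<close> is a \<open>k\<close>-form; \<open>nths\<close> deletes
  the entries at the given indices.
\<close>

definition ext_deriv ::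
    "('x \<Rightarrow> real) set \<Rightarrow> nat \<Rightarrow> 'x form \<Rightarrow> 'x vector_field list \<Rightarrow> 'x \<Rightarrow> complex" where
  "ext_deriv C k \<alpha> Vs x =
     (\<Sum>i\<le>k. (-1) ^ i * cderiv ((Vs ! i) x) (on_fields \<alpha> (nths Vs (- {i})))) +
     (\<Sum>j\<le>k. \<Sum>i<j. (-1) ^ (i + j) *
        on_fields \<alpha> (lie_bracket C (Vs ! i) (Vs ! j) # nths Vs (- {i, j})) x)"

definition closed_form :: "'x set \<Rightarrow> ('x \<Rightarrow> real) set \<Rightarrow> nat \<Rightarrow> 'x form \<Rightarrow> bool" where
  "closed_form X C k \<alpha> \<longleftrightarrow>
     (\<forall>Vs. length Vs = Suc k \<and> set Vs \<subseteq> vector_fields X C \<longrightarrow>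
        (\<forall>x\<in>X. ext_deriv C k \<alpha> Vs x = 0))"

section \<open>Complex structures, metrics and coframes\<close>

type_synonym 'x endo_field = "'x \<Rightarrow> 'x tangent_vector \<Rightarrow> 'x tangent_vector"

definition apply_endo :: "'x set \<Rightarrow> 'x endo_field \<Rightarrow> 'x vector_field \<Rightarrow> 'x vector_field" where
  "apply_endo X J V = (\<lambda>x. if x \<in> X then J x (V x) else (\<lambda>_. 0))"

definition almost_complex_structure :: "'x set \<Rightarrow> ('x \<Rightarrow> real) set \<Rightarrow> 'x endo_field \<Rightarrow> bool" where
  "almost_complex_structure X C J \<longleftrightarrow>
     (\<forall>x\<in>X. \<forall>v\<in>tangent_space C x.
        J x v \<in> tangent_space C x \<and> J x (J x v) = (\<lambda>f. - v f) \<and>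
        (\<forall>w\<in>tangent_space C x. \<forall>a b. J x (lin a v b w) = lin a (J x v) b (J x w))) \<and>
     (\<forall>V\<in>vector_fields X C. apply_endo X J V \<in> vector_fields X C)"

text \<open>Integrability is the vanishing of the Nijenhuis tensor.\<close>

definition complex_structure :: "'x set \<Rightarrow> ('x \<Rightarrow> real) set \<Rightarrow> 'x endo_field \<Rightarrow> bool" where
  "complex_structure X C J \<longleftrightarrow>
     almost_complex_structure X C J \<and>
     (\<forall>V\<in>vector_fields X C. \<forall>W\<in>vector_fields X C. \<forall>x\<in>X. \<forall>f.
        lie_bracket C (apply_endo X J V) (apply_endo X J W) x f
        - J x (lie_bracket C (apply_endo X J V) W x) f
        - J x (lie_bracket C V (apply_endo X J W) x) f
        - lie_bracket C V W x f = 0)"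

definition hermitian_metric ::
    "'x set \<Rightarrow> ('x \<Rightarrow> real) set \<Rightarrow> 'x endo_field \<Rightarrow>
     ('x \<Rightarrow> 'x tangent_vector \<Rightarrow> 'x tangent_vector \<Rightarrow> real) \<Rightarrow> bool" where
  "hermitian_metric X C J g \<longleftrightarrow>
     (\<forall>x\<in>X. \<forall>v\<in>tangent_space C x. \<forall>w\<in>tangent_space C x.
        g x v w = g x w v \<and> g x (J x v) (J x w) = g x v w \<and>
        (\<forall>u\<in>tangent_space C x. \<forall>a b. g x (lin a v b w) u = a * g x v u + b * g x w u) \<and>
        (v \<noteq> (\<lambda>_. 0) \<longrightarrow> 0 < g x v v)) \<and>
     (\<forall>V\<in>vector_fields X C. \<forall>W\<in>vector_fields X C.
        (\<lambda>x. if x \<in> X then g x (V x) (W x) else 0) \<in> C)"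

definition fundamental_form ::
    "'x set \<Rightarrow> 'x endo_field \<Rightarrow> ('x \<Rightarrow> 'x tangent_vector \<Rightarrow> 'x tangent_vector \<Rightarrow> real) \<Rightarrow> 'x form" where
  "fundamental_form X J g =
     (\<lambda>x vs. if x \<in> X then of_real (g x (J x (vs ! 0)) (vs ! 1)) else 0)"

definition kaehler_metric ::
    "'x set \<Rightarrow> ('x \<Rightarrow> real) set \<Rightarrow> 'x endo_field \<Rightarrow>
     ('x \<Rightarrow> 'x tangent_vector \<Rightarrow> 'x tangent_vector \<Rightarrow> real) \<Rightarrow> bool" where
  "kaehler_metric X C J g \<longleftrightarrow>
     hermitian_metric X C J g \<and> closed_form X C 2 (fundamental_form X J g)"

text \<open>
  A global frame \<open>\<phi> 1, \<phi> 2, \<phi> 3\<close> of the bundle of complex-valued covectors of type \<open>(1,0)\<close>, i.e.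
  those with \<open>\<alpha> \<circ> J = \<i> \<alpha>\<close>.
\<close>

definition covectors_10 ::
    "('x \<Rightarrow> real) set \<Rightarrow> 'x endo_field \<Rightarrow> 'x \<Rightarrow> ('x tangent_vector \<Rightarrow> complex) set" where
  "covectors_10 C J x =
     {\<alpha>. \<forall>v\<in>tangent_space C x. \<alpha> (J x v) = \<i> * \<alpha> v \<and>
          (\<forall>w\<in>tangent_space C x. \<forall>a b. \<alpha> (lin a v b w) = of_real a * \<alpha> v + of_real b * \<alpha> w)}"

definition coframe_10 ::
    "'x set \<Rightarrow> ('x \<Rightarrow> real) set \<Rightarrow> 'x endo_field \<Rightarrow> (nat \<Rightarrow> 'x form) \<Rightarrow> bool" where
  "coframe_10 X C J \<phi> \<longleftrightarrow>
     (\<forall>k\<in>{1..3}. is_form X C 1 (\<phi> k)) \<and>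
     (\<forall>x\<in>X.
        (\<forall>k\<in>{1..3}. (\<lambda>v. \<phi> k x [v]) \<in> covectors_10 C J x) \<and>
        (\<forall>a. (\<forall>v\<in>tangent_space C x. (\<Sum>k=1..3. a k * \<phi> k x [v]) = 0) \<longrightarrow>
             (\<forall>k\<in>{1..3}. a k = 0)) \<and>
        (\<forall>\<alpha>\<in>covectors_10 C J x.
             \<exists>a. \<forall>v\<in>tangent_space C x. \<alpha> v = (\<Sum>k=1..3. a k * \<phi> k x [v])))"

text \<open>
  A holomorphic volume form is a nowhere vanishing \<open>(3,0)\<close>-form annihilated by \<open>\<partial>\<close>-bar. In complex
  dimension 3 a \<open>(3,0)\<close>-form \<open>\<Psi>\<close> has \<open>\<partial>\<Psi> = 0\<close> for degree reasons, so this says \<open>d\<Psi> = 0\<close>. By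
  skew-symmetry the type condition needs to be stated for the first argument only.
\<close>

definition holomorphic_volume_form ::
    "'x set \<Rightarrow> ('x \<Rightarrow> real) set \<Rightarrow> 'x endo_field \<Rightarrow> 'x form \<Rightarrow> bool" where
  "holomorphic_volume_form X C J \<Psi> \<longleftrightarrow>
     is_form X C 3 \<Psi> \<and>
     (\<forall>x\<in>X. \<forall>u\<in>tangent_space C x. \<forall>v\<in>tangent_space C x. \<forall>w\<in>tangent_space C x.
        \<Psi> x [J x u, v, w] = \<i> * \<Psi> x [u, v, w]) \<and>
     (\<forall>x\<in>X. \<exists>u\<in>tangent_space C x. \<exists>v\<in>tangent_space C x. \<exists>w\<in>tangent_space C x.
        \<Psi> x [u, v, w] \<noteq> 0) \<and>
     closed_form X C 3 \<Psi>"

definition coframe_omega :: "(nat \<Rightarrow> 'x form) \<Rightarrow> 'x form" where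
  "coframe_omega \<phi> =
     (\<lambda>x vs. \<i> / 2 * (\<Sum>k=1..3. wedge 1 1 (\<phi> k) (\<lambda>y ws. cnj (\<phi> k y ws)) x vs))"

definition coframe_Omega :: "(nat \<Rightarrow> 'x form) \<Rightarrow> 'x form" where
  "coframe_Omega \<phi> = wedge 2 1 (wedge 1 1 (\<phi> 1) (\<phi> 2)) (\<phi> 3)"

text \<open>The real 1-forms with \<open>\<phi>\<^sup>k = \<theta>\<^sup>k + \<i> \<theta>\<^sup>3\<^sup>+\<^sup>k\<close> for \<open>k = 1, 2, 3\<close>.\<close>

definition real_coframe :: "(nat \<Rightarrow> 'x form) \<Rightarrow> nat \<Rightarrow> 'x \<Rightarrow> 'x tangent_vector \<Rightarrow> real" where
  "real_coframe \<phi> k x v = (if k \<le> 3 then Re (\<phi> k x [v]) else Im (\<phi> (k - 3) x [v]))"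

definition dual_frame ::
    "'x set \<Rightarrow> ('x \<Rightarrow> real) set \<Rightarrow> (nat \<Rightarrow> 'x \<Rightarrow> 'x tangent_vector \<Rightarrow> real) \<Rightarrow>
     (nat \<Rightarrow> 'x vector_field) \<Rightarrow> bool" where
  "dual_frame X C \<theta> E \<longleftrightarrow>
     (\<forall>j\<in>{1..6}. E j \<in> vector_fields X C) \<and>
     (\<forall>x\<in>X. \<forall>i\<in>{1..6}. \<forall>j\<in>{1..6}. \<theta> i x (E j x) = (if i = j then 1 else 0))"

section \<open>Special Lagrangian distributions\<close>

text \<open>
  A distribution is given by an unordered (finite) set of vector fields that span it; a form vanishes
  on it when it vanishes on all tuples of tangent vectors in the span.
\<close>

definition distribution_at :: "'x vector_field set \<Rightarrow> 'x \<Rightarrow> 'x tangent_vector set" where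
  "distribution_at D x = {v. \<exists>c. v = (\<lambda>f. \<Sum>V\<in>D. c V * V x f)}"

definition vanishes_on :: "'x set \<Rightarrow> nat \<Rightarrow> 'x form \<Rightarrow> 'x vector_field set \<Rightarrow> bool" where
  "vanishes_on X k \<alpha> D \<longleftrightarrow>
     (\<forall>x\<in>X. \<forall>vs. length vs = k \<and> set vs \<subseteq> distribution_at D x \<longrightarrow> \<alpha> x vs = 0)"

definition slag_distribution ::
    "'x set \<Rightarrow> 'x form \<Rightarrow> 'x form \<Rightarrow> real \<Rightarrow> 'x vector_field set \<Rightarrow> bool" where
  "slag_distribution X \<omega> \<Omega> t D \<longleftrightarrow>
     vanishes_on X 2 \<omega> D \<and>
     vanishes_on X 3 (\<lambda>x vs. of_real (Im (exp (- \<i> * of_real t) * \<Omega> x vs))) D"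

end

theory Submission
  imports Defs
begin

text \<open>
  At every point \<open>\<phi>\<^sup>k\<close> takes the value \<open>1\<close> on \<open>E\<^sub>k\<close>, the value \<open>\<i>\<close> on \<open>E\<^sub>3\<^sub>+\<^sub>k\<close>, and \<open>0\<close> on the other
  frame fields, so the question is one of linear algebra at a point. There
  \<open>\<omega> = \<theta>\<^sup>1 \<and> \<theta>\<^sup>4 + \<theta>\<^sup>2 \<and> \<theta>\<^sup>5 + \<theta>\<^sup>3 \<and> \<theta>\<^sup>6\<close>, so \<open>\<omega>\<close> vanishes on the span of a set of frame fields iff
  that set contains no pair \<open>{E\<^sub>k, E\<^sub>3\<^sub>+\<^sub>k}\<close>. A triple with this property has to contain exactly one
  field from each of the three pairs: it is obtained from \<open>{E\<^sub>1, E\<^sub>2, E\<^sub>3}\<close> by replacing \<open>E\<^sub>k\<close> with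
  \<open>E\<^sub>3\<^sub>+\<^sub>k\<close> for the \<open>k\<close> in some subset \<open>T\<close> of \<open>{1, 2, 3}\<close>. On its span \<open>\<phi>\<^sup>k\<close> is real-valued for
  \<open>k \<notin> T\<close> and imaginary for \<open>k \<in> T\<close>, so \<open>\<Omega>\<close>, the determinant of the \<open>\<phi>\<^sup>k\<close>, is \<open>\<i>\<close> to the power
  \<open>|T|\<close> times a real determinant that equals \<open>1\<close> on the frame fields themselves. Hence \<open>Im \<Omega>\<close>
  vanishes iff \<open>|T|\<close> is even (\<open>slag_iff_even_flip\<close>), and the four even subsets
  of \<open>{1, 2, 3}\<close> give the four triples.
\<close>

section \<open>Exterior products of 1-forms\<close>

lemma wedge_1_1:
  "wedge 1 1 \<alpha> \<beta> x [v, w] = \<alpha> x [v] * \<beta> x [w] - \<alpha> x [w] * \<beta> x [v]"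
proof -
  have 1: "{..<1 + 1} = insert (0::nat) {1}" by auto
  show ?thesis
    unfolding wedge_def 1
    by (subst sum_over_permutations_insert)
      (auto simp: permutes_sing sign_swap_id sign_compose permutation_swap_id upt_rec)
qed

text \<open>
  The sum over all permutations of three arguments meets each of the six terms of the determinant
  twice, because the inner product is itself skew; the factor \<open>2! 1!\<close> in the denominator compensates.
\<close>

lemma wedge_1_1_1:
  "wedge 2 1 (wedge 1 1 \<alpha> \<beta>) \<gamma> x [u, v, w] =
     \<alpha> x [u] * (\<beta> x [v] * \<gamma> x [w] - \<beta> x [w] * \<gamma> x [v])
   - \<alpha> x [v] * (\<beta> x [u] * \<gamma> x [w] - \<beta> x [w] * \<gamma> x [u])
   + \<alpha> x [w] * (\<beta> x [u] * \<gamma> x [v] - \<beta> x [v] * \<gamma> x [u])"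
proof -
  have 1: "{..<2 + 1} = insert (0::nat) (insert 1 {2})" by auto
  have 2: "map f [0..<2] = [f 0, f 1]" "map f [2..<2+1] = [f 2]" for f :: "nat \<Rightarrow> 'b"
    by (simp_all add: upt_rec)
  show ?thesis
    unfolding wedge_def[of 2 1] 1 2 wedge_1_1
    by (simp add: sum_over_permutations_insert permutes_sing sign_swap_id sign_compose
        permutation_swap_id permutation_compose)
      (simp add: transpose_def algebra_simps)
qed

section \<open>Linear algebra of a frame adapted to a complex coframe\<close>

lemma zero_in_tangent_space: "(\<lambda>_. 0) \<in> tangent_space C x"
  by (simp add: tangent_space_def)

lemma lin_in_tangent_space:
  assumes "v \<in> tangent_space C x" "w \<in> tangent_space C x"
  shows "lin a v b w \<in> tangent_space C x"
  using assms by (simp add: tangent_space_def lin_def algebra_simps)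

text \<open>
  The data that the pointwise computation runs on: complex-valued 1-forms, linear on each tangent
  space, and vector fields dual to their real and imaginary parts. The point of \<open>X\<close> makes the
  fields distinct, so that sets of fields correspond to sets of indices.
\<close>

locale adapted_frame =
  fixes X :: "'x set" and C :: "('x \<Rightarrow> real) set"
    and \<phi> :: "nat \<Rightarrow> 'x form" and E :: "nat \<Rightarrow> 'x vector_field"
  assumes tangent: "\<lbrakk>x \<in> X; j \<in> {1..6}\<rbrakk> \<Longrightarrow> E j x \<in> tangent_space C x"
    and linear: "\<lbrakk>x \<in> X; k \<in> {1..3}; v \<in> tangent_space C x; w \<in> tangent_space C x\<rbrakk> \<Longrightarrow>
      \<phi> k x [lin a v b w] = of_real a * \<phi> k x [v] + of_real b * \<phi> k x [w]"
    and frame: "\<lbrakk>x \<in> X; k \<in> {1..3}; j \<in> {1..6}\<rbrakk> \<Longrightarrow>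
      \<phi> k x [E j x] = (if j = k then 1 else if j = k + 3 then \<i> else 0)"
    and nonempty: "X \<noteq> {}"
begin

lemma inj_on_frame: "inj_on E {1..6}"
proof (rule inj_onI)
  fix i j :: nat assume ij: "i \<in> {1..6}" "j \<in> {1..6}" "E i = E j"
  obtain x where x: "x \<in> X" using nonempty by blast
  define k where "k = (if i \<le> 3 then i else i - 3)"
  have k: "k \<in> {1..3}" "i = k \<or> i = k + 3" using ij(1) by (auto simp: k_def)
  have "\<phi> k x [E i x] = \<phi> k x [E j x]" using ij(3) by simp
  with k show "i = j" by (auto simp: frame[OF x k(1) ij(1)] frame[OF x k(1) ij(2)] split: if_splits)
qed

lemma frame_sum:
  assumes x: "x \<in> X" and k: "k \<in> {1..3}" and S: "finite S" "S \<subseteq> {1..6}"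
  shows "(\<lambda>f. \<Sum>j\<in>S. c j * E j x f) \<in> tangent_space C x \<and>
    \<phi> k x [\<lambda>f. \<Sum>j\<in>S. c j * E j x f] = (\<Sum>j\<in>S. of_real (c j) * \<phi> k x [E j x])"
  using S
proof (induction S rule: finite_induct)
  case empty
  show ?case
    using linear[OF x k zero_in_tangent_space zero_in_tangent_space, of 0 0]
    by (simp add: zero_in_tangent_space lin_def)
next
  case (insert i S)
  have "(\<lambda>f. \<Sum>j\<in>insert i S. c j * E j x f) = lin (c i) (E i x) 1 (\<lambda>f. \<Sum>j\<in>S. c j * E j x f)"
    using insert.hyps by (simp add: lin_def)
  with insert tangent[OF x, of i] show ?case
    by (simp add: linear[OF x k] lin_in_tangent_space)
qed

lemma distribution_at_frame:
  assumes "S \<subseteq> {1..6}"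
  shows "distribution_at (E ` S) x = {v. \<exists>c. v = (\<lambda>f. \<Sum>j\<in>S. c j * E j x f)}"
proof -
  have inj: "inj_on E S" using inj_on_frame assms by (rule inj_on_subset)
  have eq: "(\<Sum>V\<in>E ` S. c V * V x f) = (\<Sum>j\<in>S. c (E j) * E j x f)" for c f
    by (simp add: sum.reindex[OF inj])
  show ?thesis
    unfolding distribution_at_def eq
  proof (intro Collect_cong iffI; elim exE)
    fix v c assume "v = (\<lambda>f. \<Sum>j\<in>S. c (E j) * E j x f)"
    then show "\<exists>c. v = (\<lambda>f. \<Sum>j\<in>S. c j * E j x f)"
      by (intro exI[of _ "\<lambda>j. c (E j)"])
  next
    fix v c assume "v = (\<lambda>f. \<Sum>j\<in>S. c j * E j x f)"
    then show "\<exists>c. v = (\<lambda>f. \<Sum>j\<in>S. c (E j) * E j x f)"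
      by (intro exI[of _ "\<lambda>V. c (inv_into S E V)"]) (simp add: inv_into_f_f[OF inj])
  qed
qed

lemma frame_in_distribution:
  assumes "S \<subseteq> {1..6}" "j \<in> S"
  shows "E j x \<in> distribution_at (E ` S) x"
proof -
  have "of_bool (i = j) * E i x f = (if i = j then E i x f else 0)" for i f by simp
  then have "E j x = (\<lambda>f. \<Sum>i\<in>S. of_bool (i = j) * E i x f)"
    using assms(2) finite_subset[OF assms(1)] by (simp only: sum.delta if_True) simp
  then show ?thesis unfolding distribution_at_frame[OF assms(1)]
    by (intro CollectI exI[of _ "\<lambda>i. of_bool (i = j)"])
qed

text \<open>
  On the span of \<open>E ` S\<close> the real part of \<open>\<phi>\<^sup>k\<close> can be nonzero only if \<open>k \<in> S\<close>, and the imaginary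
  part only if \<open>k + 3 \<in> S\<close>. Both special Lagrangian equations are read off from this.
\<close>

lemma coframe_on_distribution:
  assumes "x \<in> X" "S \<subseteq> {1..6}" "v \<in> distribution_at (E ` S) x"
  obtains c where "\<And>k. k \<in> {1..3} \<Longrightarrow>
    \<phi> k x [v] = of_real (of_bool (k \<in> S) * c k) + \<i> * of_real (of_bool (k + 3 \<in> S) * c (k + 3))"
proof -
  obtain c where v: "v = (\<lambda>f. \<Sum>j\<in>S. c j * E j x f)"
    using assms(3) unfolding distribution_at_frame[OF assms(2)] by blast
  have fin: "finite S" using assms(2) finite_subset by blast
  show thesis
  proof (rule that[of c])
    fix k :: nat assume k: "k \<in> {1..3}"
    have "\<phi> k x [v] = (\<Sum>j\<in>S. of_real (c j) * \<phi> k x [E j x])"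
      using frame_sum[OF assms(1) k fin assms(2)] v by blast
    also have "\<dots> = (\<Sum>j\<in>S. (if j = k then of_real (c j) else 0) +
        (if j = k + 3 then \<i> * of_real (c j) else 0))"
      using assms(2) by (intro sum.cong) (auto simp: frame[OF assms(1) k])
    also have "\<dots> = of_real (of_bool (k \<in> S) * c k) +
        \<i> * of_real (of_bool (k + 3 \<in> S) * c (k + 3))"
      using fin by (simp add: sum.distrib)
    finally show "\<phi> k x [v] = \<dots>" .
  qed
qed

section \<open>The two special Lagrangian equations\<close>

lemma coframe_omega_eq:
  "coframe_omega \<phi> x [v, w] = - (\<Sum>k=1..3. of_real (Im (\<phi> k x [v] * cnj (\<phi> k x [w]))))"
proof -
  have "\<i> / 2 * (a * cnj b - b * cnj a) = - of_real (Im (a * cnj b))" for a b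
    by (simp add: complex_eq_iff)
  then show ?thesis
    unfolding coframe_omega_def wedge_1_1 sum_distrib_left sum_negf[symmetric]
    by (intro sum.cong refl)
qed

text \<open>
  If no pair \<open>{k, k + 3}\<close> lies in \<open>S\<close>, the values of each \<open>\<phi>\<^sup>k\<close> on the span lie on one real line
  in the complex plane, and \<open>\<phi>\<^sup>k(v)\<close> times the conjugate of \<open>\<phi>\<^sup>k(w)\<close> is real.
\<close>

lemma omega_vanishes_iff:
  assumes S: "S \<subseteq> {1..6}"
  shows "vanishes_on X 2 (coframe_omega \<phi>) (E ` S) \<longleftrightarrow> (\<forall>k\<in>{1..3}. \<not> (k \<in> S \<and> k + 3 \<in> S))"
proof
  assume van: "vanishes_on X 2 (coframe_omega \<phi>) (E ` S)"
  obtain x where x: "x \<in> X" using nonempty by blast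
  show "\<forall>k\<in>{1..3}. \<not> (k \<in> S \<and> k + 3 \<in> S)"
  proof (intro ballI notI)
    fix k :: nat assume k: "k \<in> {1..3}" and kS: "k \<in> S \<and> k + 3 \<in> S"
    have "coframe_omega \<phi> x [E k x, E (k + 3) x] = 0"
      using van x kS frame_in_distribution[OF S] by (simp add: vanishes_on_def)
    moreover have "(\<Sum>l=1..3. complex_of_real (Im (\<phi> l x [E k x] * cnj (\<phi> l x [E (k + 3) x])))) =
        (\<Sum>l=1..3. if l = k then - 1 else 0)"
      using k by (intro sum.cong) (auto simp: frame[OF x])
    ultimately show False using k by (simp add: coframe_omega_eq)
  qed
next
  assume no_pair: "\<forall>k\<in>{1..3}. \<not> (k \<in> S \<and> k + 3 \<in> S)"
  show "vanishes_on X 2 (coframe_omega \<phi>) (E ` S)"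
    unfolding vanishes_on_def
  proof (intro ballI allI impI)
    fix x vs assume x: "x \<in> X" and vs: "length vs = 2 \<and> set vs \<subseteq> distribution_at (E ` S) x"
    then obtain v w where vw: "vs = [v, w]" by (auto simp: numeral_eq_Suc length_Suc_conv)
    obtain c d where c: "\<And>k. k \<in> {1..3} \<Longrightarrow>
        \<phi> k x [v] = of_real (of_bool (k \<in> S) * c k) + \<i> * of_real (of_bool (k + 3 \<in> S) * c (k + 3))"
      and d: "\<And>k. k \<in> {1..3} \<Longrightarrow>
        \<phi> k x [w] = of_real (of_bool (k \<in> S) * d k) + \<i> * of_real (of_bool (k + 3 \<in> S) * d (k + 3))"
      using coframe_on_distribution[OF x S] vs vw by (metis list.set_intros subsetD)
    have "Im (\<phi> k x [v] * cnj (\<phi> k x [w])) = 0" if "k \<in> {1..3}" for k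
      using no_pair that by (auto simp: c[OF that] d[OF that])
    then show "coframe_omega \<phi> x vs = 0" by (simp add: vw coframe_omega_eq)
  qed
qed

text \<open>The index set of the triple in which \<open>E\<^sub>k\<close> is replaced by \<open>E\<^sub>k\<^sub>+\<^sub>3\<close> for all \<open>k \<in> T\<close>.\<close>

definition flip :: "nat set \<Rightarrow> nat set" where
  "flip T = ({1..3} - T) \<union> (\<lambda>k. k + 3) ` T"

lemma i_power_card:
  fixes T :: "nat set"
  assumes "T \<subseteq> {1..3}"
  defines "e \<equiv> \<lambda>k. if k \<in> T then \<i> else 1"
  shows "\<i> ^ card T = e 1 * e 2 * e 3"
proof -
  have "\<i> ^ card T = (\<Prod>k\<in>T. \<i>)" by simp
  also have "\<dots> = (\<Prod>k\<in>{1..3}. e k)"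
    unfolding e_def using assms(1) by (simp add: prod.If_cases Int_absorb1)
  also have "{1..3} = {1, 2, 3::nat}" by auto
  finally show ?thesis by (simp add: mult.assoc)
qed

text \<open>
  Each row of the determinant, being the values of one \<open>\<phi>\<^sup>k\<close>, is a real row multiplied by \<open>\<i>\<close> or
  by \<open>1\<close>; the scalars come out of the determinant by multilinearity.
\<close>

lemma coframe_Omega_on_flip:
  assumes x: "x \<in> X" and T: "T \<subseteq> {1..3}"
    and vs: "set [u, v, w] \<subseteq> distribution_at (E ` flip T) x"
  shows "\<exists>r. coframe_Omega \<phi> x [u, v, w] = \<i> ^ card T * of_real r"
proof -
  have S: "flip T \<subseteq> {1..6}" using T by (fastforce simp: flip_def)
  define e where "e k = (if k \<in> T then \<i> else 1)" for k
  have "\<exists>r. \<forall>k\<in>{1..3}. \<phi> k x [y] = e k * of_real (r k)" if y: "y \<in> distribution_at (E ` flip T) x" for y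
  proof -
    obtain c where c: "\<And>k. k \<in> {1..3} \<Longrightarrow> \<phi> k x [y] =
        of_real (of_bool (k \<in> flip T) * c k) + \<i> * of_real (of_bool (k + 3 \<in> flip T) * c (k + 3))"
      using coframe_on_distribution[OF x S y] by metis
    have "k \<in> flip T \<longleftrightarrow> k \<notin> T" "k + 3 \<in> flip T \<longleftrightarrow> k \<in> T" if "k \<in> {1..3}" for k
      using that T by (auto simp: flip_def)
    then have "\<forall>k\<in>{1..3}. \<phi> k x [y] = e k * of_real (if k \<in> T then c (k + 3) else c k)"
      by (simp add: c e_def)
    then show ?thesis by (rule exI[of _ "\<lambda>k. if k \<in> T then c (k + 3) else c k"])
  qed
  then obtain a b c where
    a: "\<forall>k\<in>{1..3}. \<phi> k x [u] = e k * of_real (a k)" and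
    b: "\<forall>k\<in>{1..3}. \<phi> k x [v] = e k * of_real (b k)" and
    c: "\<forall>k\<in>{1..3}. \<phi> k x [w] = e k * of_real (c k)"
    using vs by (metis list.set_intros subsetD)
  have e: "\<i> ^ card T = e 1 * e 2 * e 3"
    using i_power_card[OF T] by (simp only: e_def)
  show ?thesis
    unfolding e
    \<comment> \<open>the determinant of the real rows\<close>
    by (rule exI[of _ "a 1 * (b 2 * c 3 - c 2 * b 3) - b 1 * (a 2 * c 3 - c 2 * a 3)
        + c 1 * (a 2 * b 3 - b 2 * a 3)"])
      (use a b c in \<open>simp add: coframe_Omega_def wedge_1_1_1[simplified] algebra_simps\<close>)
qed

text \<open>
  On the frame fields themselves the matrix is diagonal. The value is nonzero, so an odd \<open>T\<close> does
  give a nonzero imaginary part.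
\<close>

lemma coframe_Omega_flip_frame:
  assumes x: "x \<in> X" and T: "T \<subseteq> {1..3}"
  defines "s \<equiv> \<lambda>k. if k \<in> T then k + 3 else k"
  shows "coframe_Omega \<phi> x [E (s 1) x, E (s 2) x, E (s 3) x] = \<i> ^ card T"
proof -
  have e: "\<phi> k x [E (s l) x] = (if k = l then if k \<in> T then \<i> else 1 else 0)"
    if "k \<in> {1..3}" "l \<in> {1..3}" for k l
    using that by (auto simp: s_def frame[OF x])
  show ?thesis
    unfolding coframe_Omega_def wedge_1_1_1 i_power_card[OF T] by (simp add: e)
qed

lemma Im_i_power_times_real: "Im (\<i> ^ n * of_real r) = 0 \<longleftrightarrow> even n \<or> r = 0"
proof (cases "even n")
  case True
  then obtain m where "n = 2 * m" by (elim evenE)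
  then have "\<i> ^ n = of_real ((- 1) ^ m)" by (simp add: power_mult)
  with True show ?thesis by (simp only: Im_complex_of_real of_real_mult[symmetric] simp_thms)
next
  case False
  then obtain m where "n = 2 * m + 1" by (elim oddE)
  then have "\<i> ^ n = \<i> * of_real ((- 1) ^ m)" by (simp add: power_mult)
  then have "Im (\<i> ^ n * of_real r) = (- 1) ^ m * r"
    by (simp only: mult.assoc of_real_mult[symmetric] Im_i_times Re_complex_of_real)
  with False show ?thesis by (simp only: mult_eq_0_iff power_eq_0_iff) simp
qed

lemma Im_Omega_vanishes_iff:
  assumes T: "T \<subseteq> {1..3}"
  shows "vanishes_on X 3 (\<lambda>x vs. of_real (Im (coframe_Omega \<phi> x vs))) (E ` flip T) \<longleftrightarrow>
    even (card T)"
proof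
  assume van: "vanishes_on X 3 (\<lambda>x vs. of_real (Im (coframe_Omega \<phi> x vs))) (E ` flip T)"
  obtain x where x: "x \<in> X" using nonempty by blast
  define s where "s k = (if k \<in> T then k + 3 else k)" for k
  have S: "flip T \<subseteq> {1..6}" using T by (fastforce simp: flip_def)
  have "s k \<in> flip T" if "k \<in> {1..3}" for k
    using that by (auto simp: s_def flip_def)
  then have "set [E (s 1) x, E (s 2) x, E (s 3) x] \<subseteq> distribution_at (E ` flip T) x"
    using frame_in_distribution[OF S] by simp
  then have "Im (coframe_Omega \<phi> x [E (s 1) x, E (s 2) x, E (s 3) x]) = 0"
    using van x unfolding vanishes_on_def
    by (metis length_Cons list.size(3) numeral_3_eq_3 of_real_eq_0_iff)
  then have "Im (\<i> ^ card T) = 0"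
    using coframe_Omega_flip_frame[OF x T] by (simp only: s_def)
  then show "even (card T)" using Im_i_power_times_real[of _ 1] by simp
next
  assume "even (card T)"
  then have real: "Im (\<i> ^ card T * of_real r) = 0" for r
    by (simp only: Im_i_power_times_real simp_thms)
  show "vanishes_on X 3 (\<lambda>x vs. of_real (Im (coframe_Omega \<phi> x vs))) (E ` flip T)"
    unfolding vanishes_on_def
  proof (intro ballI allI impI)
    fix x vs assume x: "x \<in> X" and vs: "length vs = 3 \<and> set vs \<subseteq> distribution_at (E ` flip T) x"
    then obtain u v w where uvw: "vs = [u, v, w]" by (auto simp: numeral_eq_Suc length_Suc_conv)
    obtain r where "coframe_Omega \<phi> x vs = \<i> ^ card T * of_real r"
      using coframe_Omega_on_flip[OF x T] vs uvw by metis
    then show "complex_of_real (Im (coframe_Omega \<phi> x vs)) = 0" by (simp only: real of_real_0)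
  qed
qed

text \<open>
  The pairs \<open>{1, 4}\<close>, \<open>{2, 5}\<close>, \<open>{3, 6}\<close> partition the indices. A set that meets each of them in
  at most one index is contained in the flip of the \<open>k\<close> with \<open>k + 3 \<in> S\<close>, and a flip has at most
  three elements, so for three indices the inclusion is an equality.
\<close>

lemma transversal_eq_flip:
  assumes S: "S \<subseteq> {1..6}" "card S = 3" and no_pair: "\<forall>k\<in>{1..3}. \<not> (k \<in> S \<and> k + 3 \<in> S)"
  obtains T where "T \<subseteq> {1..3}" "S = flip T"
proof
  let ?T = "{k\<in>{1..3}. k + 3 \<in> S}"
  show "?T \<subseteq> {1..3}" by blast
  have "j \<in> flip ?T" if j: "j \<in> S" for j
  proof (cases "j \<le> 3")
    case True
    then show ?thesis using j S(1) no_pair by (auto simp: flip_def)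
  next
    case False
    then have "j = (j - 3) + 3" "j - 3 \<in> ?T" using j S(1) by auto
    then show ?thesis unfolding flip_def by blast
  qed
  moreover have "card (flip ?T) \<le> 3"
  proof -
    have "card (flip ?T) \<le> card ({1..3} - ?T) + card ((\<lambda>k. k + 3) ` ?T)"
      unfolding flip_def by (rule card_Un_le)
    also have "\<dots> \<le> card ({1..3} - ?T) + card ?T"
      by (intro add_left_mono card_image_le) simp
    also have "\<dots> = card ({1..3::nat} - ?T \<union> ?T)"
      by (rule card_Un_disjoint[symmetric]) auto
    also have "{1..3} - ?T \<union> ?T = {1..3}" by blast
    finally show ?thesis by simp
  qed
  moreover have "finite (flip ?T)" by (simp add: flip_def)
  ultimately show "S = flip ?T" using S(2) by (intro card_seteq) auto
qed

lemma slag_iff_even_flip: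
  assumes S: "S \<subseteq> {1..6}" "card S = 3"
  shows "slag_distribution X (coframe_omega \<phi>) (coframe_Omega \<phi>) 0 (E ` S) \<longleftrightarrow>
    (\<exists>T\<subseteq>{1..3}. even (card T) \<and> S = flip T)"
proof
  assume slag: "slag_distribution X (coframe_omega \<phi>) (coframe_Omega \<phi>) 0 (E ` S)"
  then obtain T where "T \<subseteq> {1..3}" "S = flip T"
    using transversal_eq_flip[OF S] omega_vanishes_iff[OF S(1)]
    unfolding slag_distribution_def by metis
  with slag Im_Omega_vanishes_iff show "\<exists>T\<subseteq>{1..3}. even (card T) \<and> S = flip T"
    by (auto simp: slag_distribution_def)
next
  assume "\<exists>T\<subseteq>{1..3}. even (card T) \<and> S = flip T"
  then obtain T where T: "T \<subseteq> {1..3}" "even (card T)" "S = flip T" by blast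
  then have "\<forall>k\<in>{1..3}. \<not> (k \<in> S \<and> k + 3 \<in> S)" by (auto simp: flip_def)
  with T show "slag_distribution X (coframe_omega \<phi>) (coframe_Omega \<phi>) 0 (E ` S)"
    using Im_Omega_vanishes_iff[OF T(1)] omega_vanishes_iff[OF S(1)]
    by (simp add: slag_distribution_def)
qed

lemma even_flips:
  "flip ` {T. T \<subseteq> {1..3} \<and> even (card T)} = {{1, 2, 3}, {1, 5, 6}, {2, 4, 6}, {3, 4, 5}}"
proof -
  have three: "{1..3} = {1, 2, 3::nat}" by auto
  have "{T. T \<subseteq> {1..3} \<and> even (card T)} = {T \<in> Pow {1, 2, 3::nat}. even (card T)}"
    by (auto simp: three)
  also have "\<dots> = {{}, {2, 3}, {1, 3}, {1, 2}}"
    by (auto simp: Pow_insert)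
  finally have subsets: "{T. T \<subseteq> {1..3} \<and> even (card T)} = {{}, {2, 3}, {1, 3}, {1, 2::nat}}" .
  have "flip {} = {1, 2, 3}" "flip {2, 3} = {1, 5, 6}" "flip {1, 3} = {2, 4, 6}"
    "flip {1, 2} = {3, 4, 5}"
    by (auto simp: flip_def)
  then show ?thesis unfolding subsets by (simp only: image_insert image_empty)
qed

lemma slag_triples:
  "{E ` S | S. S \<subseteq> {1..6} \<and> card S = 3 \<and>
      slag_distribution X (coframe_omega \<phi>) (coframe_Omega \<phi>) 0 (E ` S)} =
   {{E 1, E 2, E 3}, {E 1, E 5, E 6}, {E 2, E 4, E 6}, {E 3, E 4, E 5}}"
proof -
  have flip: "S \<subseteq> {1..6} \<and> card S = 3" if "S \<in> flip ` {T. T \<subseteq> {1..3} \<and> even (card T)}" for S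
    using that unfolding even_flips by auto
  have "S \<subseteq> {1..6} \<and> card S = 3 \<and>
      slag_distribution X (coframe_omega \<phi>) (coframe_Omega \<phi>) 0 (E ` S) \<longleftrightarrow>
      S \<in> flip ` {T. T \<subseteq> {1..3} \<and> even (card T)}" for S
    using flip[of S] slag_iff_even_flip[of S] by (auto simp only: image_iff mem_Collect_eq)
  then show ?thesis
    by (simp only: Setcompr_eq_image even_flips Collect_mem_eq image_insert image_empty)
qed

end

section \<open>Special Lagrangian distributions spanned by frame fields\<close>

lemma distinct_triples_eq_images:
  "{D. \<exists>i\<in>I. \<exists>j\<in>I. \<exists>k\<in>I. i \<noteq> j \<and> i \<noteq> k \<and> j \<noteq> k \<and> D = {E i, E j, E k} \<and> P D} =
   {E ` S | S. S \<subseteq> I \<and> card S = 3 \<and> P (E ` S)}"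
proof (intro Collect_cong iffI)
  fix D assume "\<exists>i\<in>I. \<exists>j\<in>I. \<exists>k\<in>I. i \<noteq> j \<and> i \<noteq> k \<and> j \<noteq> k \<and> D = {E i, E j, E k} \<and> P D"
  then obtain i j k where "i \<in> I" "j \<in> I" "k \<in> I" "i \<noteq> j" "i \<noteq> k" "j \<noteq> k" "D = {E i, E j, E k}" "P D"
    by blast
  then show "\<exists>S. D = E ` S \<and> S \<subseteq> I \<and> card S = 3 \<and> P (E ` S)"
    by (intro exI[of _ "{i, j, k}"]) simp
next
  fix D assume "\<exists>S. D = E ` S \<and> S \<subseteq> I \<and> card S = 3 \<and> P (E ` S)"
  then obtain S where S: "D = E ` S" "S \<subseteq> I" "card S = 3" "P (E ` S)" by blast
  then obtain i j k where "S = {i, j, k}" "i \<noteq> j" "i \<noteq> k" "j \<noteq> k"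
    unfolding card_3_iff by blast
  with S show "\<exists>i\<in>I. \<exists>j\<in>I. \<exists>k\<in>I. i \<noteq> j \<and> i \<noteq> k \<and> j \<noteq> k \<and> D = {E i, E j, E k} \<and> P D"
    by (intro bexI[of _ i] bexI[of _ j] bexI[of _ k]) simp_all
qed

lemma adapted_frame_of_coframe:
  assumes "coframe_10 X C J \<phi>" "dual_frame X C (real_coframe \<phi>) E" "X \<noteq> {}"
  shows "adapted_frame X C \<phi> E"
proof
  show "E j x \<in> tangent_space C x" if "x \<in> X" "j \<in> {1..6}" for x j
    using assms(2) that by (auto simp: dual_frame_def vector_fields_def)
  show "\<phi> k x [lin a v b w] = of_real a * \<phi> k x [v] + of_real b * \<phi> k x [w]"
    if "x \<in> X" "k \<in> {1..3}" "v \<in> tangent_space C x" "w \<in> tangent_space C x" for x k v w a b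
  proof -
    have "(\<lambda>v. \<phi> k x [v]) \<in> covectors_10 C J x"
      using assms(1) that(1,2) unfolding coframe_10_def by blast
    with that(3,4) show ?thesis unfolding covectors_10_def by blast
  qed
  show "\<phi> k x [E j x] = (if j = k then 1 else if j = k + 3 then \<i> else 0)"
    if "x \<in> X" "k \<in> {1..3}" "j \<in> {1..6}" for x k j
  proof -
    have dual: "real_coframe \<phi> i x (E j x) = (if i = j then 1 else 0)" if "i \<in> {1..6}" for i
      using assms(2) \<open>x \<in> X\<close> \<open>j \<in> {1..6}\<close> that unfolding dual_frame_def by blast
    show ?thesis
      using dual[of k] dual[of "k + 3"] that(2) by (auto simp: real_coframe_def complex_eq_iff)
  qed
qed fact

theorem proposition3p1:
  fixes G :: "'g::{t2_space, second_countable_topology} monoid"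
    and A :: "'g chart set"
    and \<Gamma> :: "'g set"
    and X :: "'g set set"
    and C :: "('g set \<Rightarrow> real) set"
    and J :: "'g set endo_field"
    and g :: "'g set \<Rightarrow> 'g set tangent_vector \<Rightarrow> 'g set tangent_vector \<Rightarrow> real"
    and \<phi> :: "nat \<Rightarrow> 'g set form"
    and \<omega> \<Omega> :: "'g set form"
    and \<theta> :: "nat \<Rightarrow> 'g set \<Rightarrow> 'g set tangent_vector \<Rightarrow> real"
    and E :: "nat \<Rightarrow> 'g set vector_field"
  assumes "lie_group G A"
    and "connected (UNIV :: 'g set)" and "simply_connected (UNIV :: 'g set)"
    and "is_lattice G \<Gamma>"
    and "X = rcosets\<^bsub>G\<^esub> \<Gamma>" and "C = quotient_smooth G A \<Gamma>"
    and "complex_structure X C J"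
    and "\<nexists>h. kaehler_metric X C J h"
    and "coframe_10 X C J \<phi>"
    and "\<Omega> = coframe_Omega \<phi>" and "holomorphic_volume_form X C J \<Omega>"
    and "\<omega> = coframe_omega \<phi>"
    and "hermitian_metric X C J g"
    and "\<forall>x\<in>X. \<forall>v\<in>tangent_space C x. \<forall>w\<in>tangent_space C x.
           \<omega> x [v, w] = fundamental_form X J g x [v, w]"
    and "closed_form X C 4 (wedge 2 2 \<omega> \<omega>)"
    and "\<theta> = real_coframe \<phi>" and "dual_frame X C \<theta> E"
  shows "{D. \<exists>i\<in>{1..6}. \<exists>j\<in>{1..6}. \<exists>k\<in>{1..6}. i \<noteq> j \<and> i \<noteq> k \<and> j \<noteq> k \<and>
             D = {E i, E j, E k} \<and> slag_distribution X \<omega> \<Omega> 0 D} =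
         {{E 1, E 2, E 3}, {E 1, E 5, E 6}, {E 2, E 4, E 6}, {E 3, E 4, E 5}}"
proof -
  have "X \<noteq> {}"
    using assms(1) by (auto simp: assms(5) lie_group_def RCOSETS_def)
  then interpret adapted_frame X C \<phi> E
    using adapted_frame_of_coframe assms(9,16,17) by blast
  show ?thesis
    unfolding assms(10,12) distinct_triples_eq_images by (rule slag_triples)
qed

end
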